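(* Let $n\ge1$, let $x\in[n]$, let $\alpha\in\mathcal{OCT}_n$ be the constant map with value $x$ and let $\beta\in\mathcal{OCT}_n$. Then $\alpha\le\beta$ if and only if $x\in\operatorname{im}\beta$.
   Context: $[n]=\{1,2,\ldots,n\}$ with its usual order. Maps are written on the right of their arguments. $\mathcal{OCT}_n$ is the semigroup (under composition, $x(\alpha\beta)=(x\alpha)\beta$) of all maps $\alpha:[n]\to[n]$ that are contractions ($|x\alpha-y\alpha|\le|x-y|$ for all $x,y\in[n]$) and order-preserving ($x\le y\Rightarrow x\alpha\le y\alpha$). $\operatorname{im}\beta$ is the image of $\beta$. The natural partial order on a semigroup $S$: $\alpha\le\beta$ iff there exist $\lambda,\mu\in S^1$ with $\alpha=\lambda\beta=\beta\mu$ and $\alpha=\alpha\mu$; here $S=\mathcal{OCT}_n$. *)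

theory Defs
  imports Main "HOL-Library.FuncSet"
begin

text \<open>A semigroup is given by a carrier \<open>S\<close> and a multiplication \<open>m\<close>. In \<open>S\<^sup>1\<close> the element
  \<open>Some s\<close> stands for \<open>s \<in> S\<close> and \<open>None\<close> for an adjoined identity, which is present only if
  \<open>S\<close> has no identity of its own.\<close>

definition has_identity :: "'a set \<Rightarrow> ('a \<Rightarrow> 'a \<Rightarrow> 'a) \<Rightarrow> bool" where
  "has_identity S m \<longleftrightarrow> (\<exists>e\<in>S. \<forall>s\<in>S. m e s = s \<and> m s e = s)"

definition S1_carrier :: "'a set \<Rightarrow> ('a \<Rightarrow> 'a \<Rightarrow> 'a) \<Rightarrow> 'a option set" where
  "S1_carrier S m = (if has_identity S m then Some ` S else insert None (Some ` S))"

fun S1_mult :: "('a \<Rightarrow> 'a \<Rightarrow> 'a) \<Rightarrow> 'a option \<Rightarrow> 'a option \<Rightarrow> 'a option" where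
  "S1_mult m None t = t"
| "S1_mult m s None = s"
| "S1_mult m (Some a) (Some b) = Some (m a b)"

definition nat_po :: "'a set \<Rightarrow> ('a \<Rightarrow> 'a \<Rightarrow> 'a) \<Rightarrow> 'a \<Rightarrow> 'a \<Rightarrow> bool" where
  "nat_po S m a b \<longleftrightarrow>
     (\<exists>l\<in>S1_carrier S m. \<exists>u\<in>S1_carrier S m.
        Some a = S1_mult m l (Some b) \<and>
        Some a = S1_mult m (Some b) u \<and>
        Some a = S1_mult m (Some a) u)"

text \<open>Maps \<open>{1..n} \<rightarrow> {1..n}\<close> are extensional functions, so that equality of functions is
  equality of maps. Distances are taken in \<^typ>\<open>int\<close> because subtraction on \<^typ>\<open>nat\<close> truncates.\<close>

definition OCT :: "nat \<Rightarrow> (nat \<Rightarrow> nat) set" where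
  "OCT n = {\<alpha> \<in> {1..n} \<rightarrow>\<^sub>E {1..n}.
     (\<forall>x\<in>{1..n}. \<forall>y\<in>{1..n}. \<bar>int (\<alpha> x) - int (\<alpha> y)\<bar> \<le> \<bar>int x - int y\<bar>) \<and>
     (\<forall>x\<in>{1..n}. \<forall>y\<in>{1..n}. x \<le> y \<longrightarrow> \<alpha> x \<le> \<alpha> y)}"

text \<open>Maps act on the right: in the product \<open>\<alpha>\<beta>\<close> the map \<open>\<alpha>\<close> is applied first.\<close>

definition OCT_mult :: "nat \<Rightarrow> (nat \<Rightarrow> nat) \<Rightarrow> (nat \<Rightarrow> nat) \<Rightarrow> (nat \<Rightarrow> nat)" where
  "OCT_mult n \<alpha> \<beta> = compose {1..n} \<beta> \<alpha>"

lemma OCT_mult_closed: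
  assumes "\<alpha> \<in> OCT n" "\<beta> \<in> OCT n"
  shows "OCT_mult n \<alpha> \<beta> \<in> OCT n"
proof -
  have im: "\<alpha> x \<in> {1..n}" "\<beta> x \<in> {1..n}" if "x \<in> {1..n}" for x
    using assms that unfolding OCT_def by auto
  have c: "\<bar>int (\<beta> (\<alpha> x)) - int (\<beta> (\<alpha> y))\<bar> \<le> \<bar>int x - int y\<bar>"
    if "x \<in> {1..n}" "y \<in> {1..n}" for x y
  proof -
    have "\<bar>int (\<beta> (\<alpha> x)) - int (\<beta> (\<alpha> y))\<bar> \<le> \<bar>int (\<alpha> x) - int (\<alpha> y)\<bar>"
      using assms(2) im(1)[OF that(1)] im(1)[OF that(2)] unfolding OCT_def by blast
    also have "\<dots> \<le> \<bar>int x - int y\<bar>"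
      using assms(1) that unfolding OCT_def by blast
    finally show ?thesis .
  qed
  have o: "\<beta> (\<alpha> x) \<le> \<beta> (\<alpha> y)" if "x \<in> {1..n}" "y \<in> {1..n}" "x \<le> y" for x y
    using assms im(1)[OF that(1)] im(1)[OF that(2)] that unfolding OCT_def by blast
  have "compose {1..n} \<beta> \<alpha> \<in> {1..n} \<rightarrow>\<^sub>E {1..n}"
    using im by (auto simp: compose_def PiE_def Pi_def)
  then show ?thesis
    using c o unfolding OCT_def OCT_mult_def by (simp add: compose_eq)
qed

lemma OCT_mult_assoc:
  assumes "\<alpha> \<in> OCT n"
  shows "OCT_mult n (OCT_mult n \<alpha> \<beta>) \<gamma> = OCT_mult n \<alpha> (OCT_mult n \<beta> \<gamma>)"
  using assms unfolding OCT_def OCT_mult_def by (auto simp: compose_def fun_eq_iff PiE_def Pi_def)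

end

theory Submission imports Defs begin

text \<open>A factorisation \<open>\<alpha> = \<lambda>\<beta>\<close> forces \<open>im \<alpha> \<subseteq> im \<beta>\<close>, hence \<open>x \<in> im \<beta>\<close>. Conversely, if \<open>y\<beta> = x\<close>,
  take for \<open>\<lambda>\<close> the constant map with value \<open>y\<close> and \<open>\<mu> = \<alpha>\<close>. Constant maps are order-preserving
  contractions; following \<open>\<lambda>\<close> by \<open>\<beta>\<close> moves its value from \<open>y\<close> to \<open>x\<close>, so \<open>\<lambda>\<beta> = \<alpha>\<close>; and
  a constant map is a right zero, so \<open>\<beta>\<alpha> = \<alpha> = \<alpha>\<alpha>\<close>.\<close>

lemma OCT_imp_funcset: "\<alpha> \<in> OCT n \<Longrightarrow> \<alpha> \<in> {1..n} \<rightarrow>\<^sub>E {1..n}"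
  by (simp add: OCT_def)

lemma constant_in_OCT:
  assumes "y \<in> {1..n}"
  shows "(\<lambda>i\<in>{1..n}. y) \<in> OCT n"
  using assms by (auto simp: OCT_def)

lemma OCT_mult_constant_right:
  assumes "\<beta> \<in> OCT n"
  shows "OCT_mult n \<beta> (\<lambda>i\<in>{1..n}. x) = (\<lambda>i\<in>{1..n}. x)"
  using OCT_imp_funcset[OF assms] by (auto simp: OCT_mult_def compose_def fun_eq_iff PiE_iff)

lemma OCT_mult_constant_left:
  "OCT_mult n (\<lambda>i\<in>{1..n}. y) \<beta> = (\<lambda>i\<in>{1..n}. \<beta> y)"
  by (auto simp: OCT_mult_def compose_def fun_eq_iff)

lemma nat_po_imp_image_subset:
  assumes "nat_po (OCT n) (OCT_mult n) \<alpha> \<beta>"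
  shows "\<alpha> ` {1..n} \<subseteq> \<beta> ` {1..n}"
proof -
  obtain l where l: "l \<in> S1_carrier (OCT n) (OCT_mult n)"
    and eq: "Some \<alpha> = S1_mult (OCT_mult n) l (Some \<beta>)"
    using assms unfolding nat_po_def by blast
  show ?thesis
  proof (cases l)
    case None
    then show ?thesis using eq by simp
  next
    case (Some \<gamma>)
    then have "\<gamma> \<in> OCT n"
      using l by (auto simp: S1_carrier_def split: if_splits)
    moreover have "\<alpha> = OCT_mult n \<gamma> \<beta>"
      using eq Some by simp
    ultimately show ?thesis
      by (auto dest!: OCT_imp_funcset simp: OCT_mult_def compose_eq PiE_iff)
  qed
qed

theorem lemma24:
  fixes n x :: nat and \<alpha> \<beta> :: "nat \<Rightarrow> nat"
  assumes "n \<ge> 1"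
    and "x \<in> {1..n}"
    and "\<alpha> \<in> OCT n"
    and "\<forall>i\<in>{1..n}. \<alpha> i = x"
    and "\<beta> \<in> OCT n"
  shows "nat_po (OCT n) (OCT_mult n) \<alpha> \<beta> \<longleftrightarrow> x \<in> \<beta> ` {1..n}"
proof
  assume "nat_po (OCT n) (OCT_mult n) \<alpha> \<beta>"
  then have "\<alpha> 1 \<in> \<beta> ` {1..n}"
    using nat_po_imp_image_subset assms(1) by fastforce
  then show "x \<in> \<beta> ` {1..n}"
    using assms(1,4) by simp
next
  assume "x \<in> \<beta> ` {1..n}"
  then obtain y where y: "y \<in> {1..n}" "\<beta> y = x" by blast
  define l where "l = (\<lambda>i\<in>{1..n}. y)"
  have \<alpha>: "\<alpha> = (\<lambda>i\<in>{1..n}. x)"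
    using OCT_imp_funcset[OF assms(3)] assms(4) by (auto simp: fun_eq_iff PiE_iff extensional_def)
  have carrier: "Some \<gamma> \<in> S1_carrier (OCT n) (OCT_mult n)" if "\<gamma> \<in> OCT n" for \<gamma>
    using that by (simp add: S1_carrier_def)
  have "\<alpha> = OCT_mult n l \<beta>"
    using OCT_mult_constant_left y(2) unfolding l_def \<alpha> by simp
  moreover have "OCT_mult n \<gamma> \<alpha> = \<alpha>" if "\<gamma> \<in> OCT n" for \<gamma>
    using OCT_mult_constant_right[OF that] unfolding \<alpha> .
  moreover have "l \<in> OCT n"
    using constant_in_OCT[OF y(1)] unfolding l_def .
  ultimately show "nat_po (OCT n) (OCT_mult n) \<alpha> \<beta>"
    unfolding nat_po_def using assms(3,5)
    by (intro bexI[of _ "Some l"] bexI[of _ "Some \<alpha>"] carrier) simp_all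
qed

end
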